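(* Let $1\le N<M$ and let $h$ be a real symmetric $M\times M$ matrix with $h_{ij}\le0$ for all $i\ne j$ whose graph $G(h)$ is a linear chain, i.e., for $i\ne j$ one has $h_{ij}\neq0$ if and only if $|i-j|=1$. Consider on $\mathcal{H}_N=\Lambda^N\mathbb{C}^M$ the Hamiltonian $$H=\sum_{i,j}h_{ij}\,\hat a_i^\dagger\hat a_j+W,$$ where $W$ is any self-adjoint interaction that is diagonal in the basis $\{e_I\}_I$. Then the ground state $\Psi=\sum_I\Psi_Ie_I$ of $H$ is non-degenerate and can be chosen such that $\Psi_I>0$ for all $I$. In particular, $\Psi$ is uniquely $v$-representable.
   Context: $X=\{1,\dots,M\}$ is the vertex set (labelled along the chain), $e_1,\dots,e_M$ the standard basis of $\mathbb{C}^M$. $\mathcal{H}_N=\Lambda^N\mathbb{C}^M$ has orthonormal basis $e_I=e_{i_1}\wedge\dots\wedge e_{i_N}$ indexed by ordered multi-indices $I=(i_1<\dots<i_N)$ in $X$; $\hat a_i^\dagger,\hat a_i$ are the fermionic creation and annihilation operators for $e_i$ (with $[\hat a_i,\hat a_j^\dagger]_+=\delta_{ij}$). A potential $u\in\mathbb{R}^M$ acts on $\mathcal{H}_N$ as $\sum_iu_i\hat a_i^\dagger\hat a_i$, i.e. $e_I\mapsto(\sum_{i\in I}u_i)e_I$. An external potential $v$ may be included in the diagonal of $h$. The graph $G(h)$ of a Hermitian matrix $h$ has vertex set $X$ and $i\sim j$ iff $i\ne j$ and $h_{ij}\ne0$. Unique $v$-representability: a ground state $\Psi$ of $H=H_0+V$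 (with $V$ the operator of the external potential $v$) is uniquely $v$-representable if there is no potential $v'$ differing from $v$ by more than a constant vector such that $\Psi$ is also a ground state of $H_0+V'$; equivalently, there is no non-constant $u\in\mathbb{R}^M$ such that $\Psi$ is a ground state of $H+\sum_iu_i\hat a_i^\dagger\hat a_i$. *)

theory Defs
  imports Complex_Main
begin

section \<open>Fermionic Fock space over the sites 1, ..., M\<close>

text \<open>
  A vector is stored through its coefficients with respect to the orthonormal basis
  \<open>e_I = e_{i_1} \<and> ... \<and> e_{i_N}\<close>, \<open>i_1 < ... < i_N\<close>; the ordered multi-index \<open>I\<close> is identified
  with the set of its entries. The N-particle space consists of the coefficient functions that
  vanish outside \<open>configs M N\<close>.
\<close>

type_synonym fock = "nat set \<Rightarrow> complex"

definition sites :: "nat \<Rightarrow> nat set" where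
  "sites M = {1..M}"

definition configs :: "nat \<Rightarrow> nat \<Rightarrow> nat set set" where
  "configs M N = {I. I \<subseteq> sites M \<and> card I = N}"

definition nspace :: "nat \<Rightarrow> nat \<Rightarrow> fock set" where
  "nspace M N = {\<psi>. \<forall>I. I \<notin> configs M N \<longrightarrow> \<psi> I = 0}"

definition basis_vec :: "nat set \<Rightarrow> fock" where
  "basis_vec I = (\<lambda>J. if J = I then 1 else 0)"

definition fock_inner :: "nat \<Rightarrow> fock \<Rightarrow> fock \<Rightarrow> complex" where
  "fock_inner M \<phi> \<psi> = (\<Sum>I\<in>Pow (sites M). cnj (\<phi> I) * \<psi> I)"

text \<open>
  The creator is \<open>e_I \<mapsto> e_i \<and> e_I\<close>. Moving \<open>e_i\<close> to its place in the increasing order costs one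
  sign for every \<open>j \<in> I\<close> with \<open>j < i\<close>. See \<open>create_basis_vec\<close> and \<open>annihilate_basis_vec\<close> for the
  action on basis vectors, \<open>create_adjoint\<close> for adjointness, the lemmas \<open>CAR\<close> for the
  anticommutation relations, and \<open>basis_vec_wedge\<close> for the wedge product.
\<close>

definition site_sign :: "nat \<Rightarrow> nat set \<Rightarrow> complex" where
  "site_sign i I = (-1) ^ card {j \<in> I. j < i}"

definition create :: "nat \<Rightarrow> fock \<Rightarrow> fock" where
  "create i \<psi> = (\<lambda>I. if i \<in> I then site_sign i I * \<psi> (I - {i}) else 0)"

definition annihilate :: "nat \<Rightarrow> fock \<Rightarrow> fock" where
  "annihilate i \<psi> = (\<lambda>I. if i \<in> I then 0 else site_sign i I * \<psi> (insert i I))"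


section \<open>Operators\<close>

definition one_body :: "nat \<Rightarrow> (nat \<Rightarrow> nat \<Rightarrow> complex) \<Rightarrow> fock \<Rightarrow> fock" where
  "one_body M h \<psi> = (\<lambda>I. \<Sum>i\<in>sites M. \<Sum>j\<in>sites M. h i j * create i (annihilate j \<psi>) I)"

definition potential_op :: "nat \<Rightarrow> (nat \<Rightarrow> real) \<Rightarrow> fock \<Rightarrow> fock" where
  "potential_op M u \<psi> = (\<lambda>I. \<Sum>i\<in>sites M. complex_of_real (u i) * create i (annihilate i \<psi>) I)"

definition op_add :: "(fock \<Rightarrow> fock) \<Rightarrow> (fock \<Rightarrow> fock) \<Rightarrow> fock \<Rightarrow> fock" where
  "op_add A B \<psi> = (\<lambda>I. A \<psi> I + B \<psi> I)"

definition linear_operator :: "nat \<Rightarrow> nat \<Rightarrow> (fock \<Rightarrow> fock) \<Rightarrow> bool" where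
  "linear_operator M N A \<longleftrightarrow>
     (\<forall>\<psi>\<in>nspace M N. A \<psi> \<in> nspace M N) \<and>
     (\<forall>\<phi>\<in>nspace M N. \<forall>\<psi>\<in>nspace M N. \<forall>a b.
        A (\<lambda>I. a * \<phi> I + b * \<psi> I) = (\<lambda>I. a * A \<phi> I + b * A \<psi> I))"

definition self_adjoint :: "nat \<Rightarrow> nat \<Rightarrow> (fock \<Rightarrow> fock) \<Rightarrow> bool" where
  "self_adjoint M N A \<longleftrightarrow> linear_operator M N A \<and>
     (\<forall>\<phi>\<in>nspace M N. \<forall>\<psi>\<in>nspace M N. fock_inner M \<phi> (A \<psi>) = fock_inner M (A \<phi>) \<psi>)"

definition diagonal_operator :: "nat \<Rightarrow> nat \<Rightarrow> (fock \<Rightarrow> fock) \<Rightarrow> bool" where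
  "diagonal_operator M N A \<longleftrightarrow>
     (\<forall>I\<in>configs M N. \<exists>c. A (basis_vec I) = (\<lambda>J. c * basis_vec I J))"


section \<open>Graph of a matrix\<close>

text \<open>Only the entries with indices in \<open>sites M\<close> are meaningful.\<close>

definition graph_adj :: "nat \<Rightarrow> (nat \<Rightarrow> nat \<Rightarrow> 'a::zero) \<Rightarrow> nat \<Rightarrow> nat \<Rightarrow> bool" where
  "graph_adj M h i j \<longleftrightarrow> i \<in> sites M \<and> j \<in> sites M \<and> i \<noteq> j \<and> h i j \<noteq> 0"

definition linear_chain :: "nat \<Rightarrow> (nat \<Rightarrow> nat \<Rightarrow> 'a::zero) \<Rightarrow> bool" where
  "linear_chain M h \<longleftrightarrow>
     (\<forall>i\<in>sites M. \<forall>j\<in>sites M. graph_adj M h i j \<longleftrightarrow> \<bar>int i - int j\<bar> = 1)"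


section \<open>Ground states and unique representability\<close>

text \<open>
  These notions concern self-adjoint operators on \<open>nspace M N\<close>, so only real eigenvalues are
  considered. A ground state is any nonzero vector of the lowest eigenspace; it is not normalized.
\<close>

definition is_eigenvector :: "nat \<Rightarrow> nat \<Rightarrow> (fock \<Rightarrow> fock) \<Rightarrow> real \<Rightarrow> fock \<Rightarrow> bool" where
  "is_eigenvector M N A E \<psi> \<longleftrightarrow>
     \<psi> \<in> nspace M N \<and> \<psi> \<noteq> (\<lambda>I. 0) \<and> A \<psi> = (\<lambda>I. complex_of_real E * \<psi> I)"

definition is_ground_state :: "nat \<Rightarrow> nat \<Rightarrow> (fock \<Rightarrow> fock) \<Rightarrow> fock \<Rightarrow> bool" where
  "is_ground_state M N A \<psi> \<longleftrightarrow>
     (\<exists>E. is_eigenvector M N A E \<psi> \<and> (\<forall>E' \<phi>. is_eigenvector M N A E' \<phi> \<longrightarrow> E \<le> E'))"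

definition nondegenerate_ground_state :: "nat \<Rightarrow> nat \<Rightarrow> (fock \<Rightarrow> fock) \<Rightarrow> bool" where
  "nondegenerate_ground_state M N A \<longleftrightarrow>
     (\<exists>\<psi>. is_ground_state M N A \<psi> \<and>
          (\<forall>\<phi>. is_ground_state M N A \<phi> \<longrightarrow> (\<exists>c. \<phi> = (\<lambda>I. c * \<psi> I))))"

definition constant_potential :: "nat \<Rightarrow> (nat \<Rightarrow> real) \<Rightarrow> bool" where
  "constant_potential M u \<longleftrightarrow> (\<exists>c. \<forall>i\<in>sites M. u i = c)"

definition uniquely_v_representable ::
    "nat \<Rightarrow> nat \<Rightarrow> (fock \<Rightarrow> fock) \<Rightarrow> (nat \<Rightarrow> real) \<Rightarrow> fock \<Rightarrow> bool" where
  "uniquely_v_representable M N H0 v \<psi> \<longleftrightarrow>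
     is_ground_state M N (op_add H0 (potential_op M v)) \<psi> \<and>
     \<not> (\<exists>v'. \<not> constant_potential M (\<lambda>i. v' i - v i) \<and>
             is_ground_state M N (op_add H0 (potential_op M v')) \<psi>)"


section \<open>Consistency of the definitions\<close>

lemma create_basis_vec:
  "create i (basis_vec I) =
     (if i \<in> I then (\<lambda>J. 0) else (\<lambda>J. site_sign i I * basis_vec (insert i I) J))"
proof -
  have "site_sign i (insert i I) = site_sign i I"
    unfolding site_sign_def by (rule arg_cong[where f = "\<lambda>S. (-1) ^ card S"]) auto
  then show ?thesis by (auto simp: create_def basis_vec_def fun_eq_iff)
qed

lemma annihilate_basis_vec:
  "annihilate i (basis_vec I) =
     (if i \<in> I then (\<lambda>J. site_sign i I * basis_vec (I - {i}) J) else (\<lambda>J. 0))"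
proof -
  have "site_sign i (I - {i}) = site_sign i I"
    unfolding site_sign_def by (rule arg_cong[where f = "\<lambda>S. (-1) ^ card S"]) auto
  then show ?thesis by (auto simp: annihilate_def basis_vec_def fun_eq_iff)
qed

lemma site_sign_square [simp]: "site_sign i I * site_sign i I = 1"
  by (simp add: site_sign_def flip: power_add)

lemma site_sign_square_left [simp]: "site_sign i I * (site_sign i I * x) = x"
  by (simp flip: mult.assoc)

lemma site_sign_insert:
  "site_sign i (insert j I) = (if j < i \<and> j \<notin> I then - site_sign i I else site_sign i I)"
proof -
  have "{k \<in> insert j I. k < i} =
      (if j < i then insert j {k \<in> I. k < i} else {k \<in> I. k < i})" by auto
  then show ?thesis by (auto simp: site_sign_def insert_absorb)
qed

lemma site_sign_remove:
  "site_sign i (I - {j}) = (if j < i \<and> j \<in> I then - site_sign i I else site_sign i I)"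
proof (cases "j \<in> I")
  case True
  then have "insert j (I - {j}) = I" by auto
  with site_sign_insert[of i j "I - {j}"] True show ?thesis by auto
qed simp

lemma number_op: "create i (annihilate i \<psi>) I = (if i \<in> I then \<psi> I else 0)"
  by (auto simp: create_def annihilate_def site_sign_remove insert_absorb)

lemma CAR_annihilate_create:
  "annihilate i (create j \<psi>) I + create j (annihilate i \<psi>) I = (if i = j then \<psi> I else 0)"
proof (cases "i = j")
  case True
  then show ?thesis
    by (auto simp: create_def annihilate_def site_sign_remove site_sign_insert insert_absorb)
next
  case False
  then have "insert i I - {j} = insert i (I - {j})" by auto
  with False show ?thesis
    by (auto simp: create_def annihilate_def site_sign_remove site_sign_insert)
qed

lemma CAR_create: "create i (create j \<psi>) I + create j (create i \<psi>) I = 0"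
  by (cases i j rule: linorder_cases)
     (auto simp: create_def site_sign_remove Diff_insert2[symmetric] insert_commute)

lemma CAR_annihilate: "annihilate i (annihilate j \<psi>) I + annihilate j (annihilate i \<psi>) I = 0"
  by (cases i j rule: linorder_cases)
     (auto simp: annihilate_def site_sign_insert insert_commute)

lemma create_adjoint:
  assumes "i \<in> sites M"
  shows "fock_inner M (create i \<phi>) \<psi> = fock_inner M \<phi> (annihilate i \<psi>)"
proof -
  have cnj_sign: "cnj (site_sign i I) = site_sign i I" for I
    by (simp add: site_sign_def)
  have fin: "finite (Pow (sites M))" by (simp add: sites_def)
  have "fock_inner M (create i \<phi>) \<psi> =
      (\<Sum>I\<in>{I \<in> Pow (sites M). i \<in> I}. site_sign i I * cnj (\<phi> (I - {i})) * \<psi> I)"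
    unfolding fock_inner_def
    by (rule sum.mono_neutral_cong_right) (use fin in \<open>auto simp: create_def cnj_sign\<close>)
  also have "\<dots> = (\<Sum>I\<in>{I \<in> Pow (sites M). i \<notin> I}.
      cnj (\<phi> I) * (site_sign i I * \<psi> (insert i I)))"
    by (rule sum.reindex_bij_witness[of _ "insert i" "\<lambda>I. I - {i}"])
       (use assms in \<open>auto simp: site_sign_remove insert_absorb\<close>)
  also have "\<dots> = fock_inner M \<phi> (annihilate i \<psi>)"
    unfolding fock_inner_def
    by (rule sum.mono_neutral_cong_left) (use fin in \<open>auto simp: annihilate_def\<close>)
  finally show ?thesis .
qed

lemma basis_vec_wedge:
  assumes "sorted_wrt (<) is"
  shows "foldr create is (basis_vec {}) = basis_vec (set is)"
  using assms
proof (induction "is")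
  case (Cons i "is")
  then have "{j \<in> set is. j < i} = {}" and "i \<notin> set is" by auto
  then have "site_sign i (set is) = 1" and "i \<notin> set is"
    by (simp_all only: site_sign_def card.empty power_0 not_False_eq_True)
  with Cons show ?case by (simp add: create_basis_vec)
qed simp

lemma potential_op_apply:
  assumes "I \<subseteq> sites M"
  shows "potential_op M u \<psi> I = complex_of_real (\<Sum>i\<in>I. u i) * \<psi> I"
proof -
  have "potential_op M u \<psi> I = (\<Sum>i\<in>I. complex_of_real (u i) * \<psi> I)"
    unfolding potential_op_def number_op
    by (rule sum.mono_neutral_cong_right) (use assms in \<open>auto simp: sites_def\<close>)
  then show ?thesis by (simp add: sum_distrib_right)
qed

lemma is_ground_state_cong:
  assumes "\<And>\<psi>. \<psi> \<in> nspace M N \<Longrightarrow> A \<psi> = B \<psi>"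
  shows "is_ground_state M N A \<psi> = is_ground_state M N B \<psi>"
proof -
  have "is_eigenvector M N A E \<phi> = is_eigenvector M N B E \<phi>" for E \<phi>
    using assms by (auto simp: is_eigenvector_def)
  then show ?thesis by (simp add: is_ground_state_def)
qed

lemma uniquely_v_representable_iff:
  assumes "\<And>\<psi>. \<psi> \<in> nspace M N \<Longrightarrow> H \<psi> = op_add H0 (potential_op M v) \<psi>"
  shows "uniquely_v_representable M N H0 v \<psi> \<longleftrightarrow>
     is_ground_state M N H \<psi> \<and>
     \<not> (\<exists>u. \<not> constant_potential M u \<and> is_ground_state M N (op_add H (potential_op M u)) \<psi>)"
proof -
  have add: "potential_op M (\<lambda>i. v i + u i) \<phi> I = potential_op M v \<phi> I + potential_op M u \<phi> I"
    for u \<phi> I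
    by (simp add: potential_op_def algebra_simps sum.distrib)
  have 1: "is_ground_state M N (op_add H0 (potential_op M v)) \<psi> = is_ground_state M N H \<psi>"
    by (rule is_ground_state_cong) (simp add: assms)
  have 2: "is_ground_state M N (op_add H0 (potential_op M (\<lambda>i. v i + u i))) \<psi> =
      is_ground_state M N (op_add H (potential_op M u)) \<psi>" for u
    by (rule is_ground_state_cong) (simp add: assms op_add_def add add.assoc)
  have "(\<exists>v'. \<not> constant_potential M (\<lambda>i. v' i - v i) \<and>
          is_ground_state M N (op_add H0 (potential_op M v')) \<psi>) \<longleftrightarrow>
        (\<exists>u. \<not> constant_potential M u \<and> is_ground_state M N (op_add H (potential_op M u)) \<psi>)"
    (is "?L \<longleftrightarrow> ?R")
  proof
    assume ?L
    then obtain v' where v': "\<not> constant_potential M (\<lambda>i. v' i - v i)"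
      "is_ground_state M N (op_add H0 (potential_op M v')) \<psi>" by blast
    with 2[of "\<lambda>i. v' i - v i"] show ?R by auto
  next
    assume ?R
    then obtain u where u: "\<not> constant_potential M u"
      "is_ground_state M N (op_add H (potential_op M u)) \<psi>" by blast
    then show ?L by (intro exI[of _ "\<lambda>i. v i + u i"]) (simp add: 2)
  qed
  with 1 show ?thesis by (simp add: uniquely_v_representable_def)
qed

end

theory Submission
  imports Defs "HOL-Analysis.Function_Topology"
begin

text \<open>On a chain a particle can only hop to a neighbouring site, which never reorders the particles,
  so no fermionic sign appears and \<open>H\<close> is a real symmetric matrix with nonpositive off-diagonal
  entries in the basis \<open>e_I\<close>. It is irreducible, because every configuration can be packed down to
  \<open>{1..N}\<close> by such hops. The Perron--Frobenius argument, applied to a minimizer of the quadratic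
  form, gives a positive nondegenerate ground state. If this vector is also an eigenvector after
  adding a potential \<open>u\<close>, then \<open>u\<close> has the same sum over all configurations and is constant.\<close>

section \<open>Perron--Frobenius for irreducible stoquastic matrices\<close>

text \<open>Irreducibility is phrased through cuts instead of paths: it will be applied to the zero
  set of an eigenvector, and on the chain it is checked by following hops on both sides of a
  cut.\<close>

locale irreducible_stoquastic =
  fixes C :: "'i set" and a :: "'i \<Rightarrow> 'i \<Rightarrow> real"
  assumes fin: "finite C" and nonempty: "C \<noteq> {}"
    and sym: "I \<in> C \<Longrightarrow> J \<in> C \<Longrightarrow> a I J = a J I"
    and off_diag: "I \<in> C \<Longrightarrow> J \<in> C \<Longrightarrow> I \<noteq> J \<Longrightarrow> a I J \<le> 0"
    and irreducible: "S \<subseteq> C \<Longrightarrow> S \<noteq> {} \<Longrightarrow> S \<noteq> C \<Longrightarrow> \<exists>I\<in>S. \<exists>J\<in>C - S. a I J \<noteq> 0"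
begin

definition quad :: "('i \<Rightarrow> real) \<Rightarrow> real" where
  "quad x = (\<Sum>I\<in>C. \<Sum>J\<in>C. a I J * x I * x J)"

definition sqnorm :: "('i \<Rightarrow> real) \<Rightarrow> real" where
  "sqnorm x = (\<Sum>I\<in>C. (x I)\<^sup>2)"

definition eigen :: "real \<Rightarrow> ('i \<Rightarrow> real) \<Rightarrow> bool" where
  "eigen E x \<longleftrightarrow> (\<forall>I\<in>C. (\<Sum>J\<in>C. a I J * x J) = E * x I)"

section \<open>The quadratic form: scaling, eigenvectors and signs\<close>

lemma quad_scale: "quad (\<lambda>I. c * x I) = c\<^sup>2 * quad x"
  unfolding quad_def sum_distrib_left by (intro sum.cong refl) (simp add: power2_eq_square)

lemma sqnorm_scale: "sqnorm (\<lambda>I. c * x I) = c\<^sup>2 * sqnorm x"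
  unfolding sqnorm_def sum_distrib_left by (simp add: power_mult_distrib)

lemma sqnorm_nonneg: "sqnorm x \<ge> 0"
  by (simp add: sqnorm_def sum_nonneg)

lemma sqnorm_eq_0: "sqnorm x = 0 \<longleftrightarrow> (\<forall>I\<in>C. x I = 0)"
  using fin by (simp add: sqnorm_def sum_nonneg_eq_0_iff)

lemma quad_eigen:
  assumes "eigen E x"
  shows "quad x = E * sqnorm x"
proof -
  have "quad x = (\<Sum>I\<in>C. x I * (\<Sum>J\<in>C. a I J * x J))"
    by (simp add: quad_def sum_distrib_left mult_ac)
  also have "\<dots> = (\<Sum>I\<in>C. x I * (E * x I))"
    using assms by (intro sum.cong) (auto simp: eigen_def)
  finally show ?thesis
    by (simp add: sqnorm_def sum_distrib_left power2_eq_square mult_ac)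
qed

text \<open>Dropping signs cannot decrease a product \<open>x I * x J\<close>, and off-diagonal
  products carry nonpositive coefficients; the diagonal terms contain squares and keep their
  value.\<close>

lemma quad_abs_le: "quad (\<lambda>I. \<bar>x I\<bar>) \<le> quad x"
  unfolding quad_def
proof (intro sum_mono)
  fix I J assume IJ: "I \<in> C" "J \<in> C"
  show "a I J * \<bar>x I\<bar> * \<bar>x J\<bar> \<le> a I J * x I * x J"
  proof (cases "I = J")
    case False
    have "a I J * (\<bar>x I\<bar> * \<bar>x J\<bar>) \<le> a I J * (x I * x J)"
      using off_diag[OF IJ False] by (intro mult_left_mono_neg) (simp_all flip: abs_mult)
    then show ?thesis by (simp add: mult_ac)
  qed (simp add: mult.assoc flip: abs_mult power2_eq_square)
qed

text \<open>A continuous function attains its minimum on the compact unit sphere, and homogeneity of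
  degree two extends the bound to all vectors.\<close>

lemma ex_minimizer: "\<exists>x. sqnorm x = 1 \<and> (\<forall>y. quad x * sqnorm y \<le> quad y)"
proof -
  \<comment> \<open>Coordinates outside \<open>C\<close> are pinned to 0, so the box is a product of
    compact sets and hence compact even if the type \<open>'i\<close> is infinite.\<close>
  define K where "K = Pi\<^sub>E UNIV (\<lambda>I. if I \<in> C then {-1..1} else {0::real}) \<inter> {x. sqnorm x = 1}"
  have "compactin (product_topology (\<lambda>_. euclidean) UNIV)
      (Pi\<^sub>E UNIV (\<lambda>I. if I \<in> C then {-1..1} else {0::real}))"
    by (subst compactin_PiE) auto
  then have box: "compact (Pi\<^sub>E UNIV (\<lambda>I. if I \<in> C then {-1..1} else {0::real}))"
    by (simp add: euclidean_product_topology)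
  have coord: "continuous_on S (\<lambda>x::'i \<Rightarrow> real. x I)" for I S
    by (rule continuous_on_product_then_coordinatewise[OF continuous_on_id])
  have "closed {x. sqnorm x = 1}"
    unfolding sqnorm_def by (intro closed_Collect_eq continuous_intros coord)
  with box have cpt: "compact K"
    by (auto simp: K_def intro: compact_Int_closed)
  have cont: "continuous_on K quad"
    unfolding quad_def by (intro continuous_intros coord)
  have in_K: "(\<lambda>I. if I \<in> C then x I else 0) \<in> K" if "sqnorm x = 1" for x
  proof -
    have "\<bar>x I\<bar> \<le> 1" if "I \<in> C" for I
    proof -
      have "(x I)\<^sup>2 \<le> sqnorm x"
        unfolding sqnorm_def using fin that by (intro member_le_sum) auto
      then show ?thesis using \<open>sqnorm x = 1\<close> by (simp add: abs_square_le_1)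
    qed
    then show ?thesis using that
      by (auto simp: K_def sqnorm_def abs_le_iff)
  qed
  have "K \<noteq> {}"
  proof -
    obtain I where "I \<in> C" using nonempty by auto
    then have "sqnorm (\<lambda>J. if J = I then 1 else 0) = 1"
      using fin by (simp add: sqnorm_def if_distrib[of "\<lambda>t. t\<^sup>2"] cong: if_cong)
    with in_K show ?thesis by blast
  qed
  then obtain x where x: "x \<in> K" "\<And>y. y \<in> K \<Longrightarrow> quad x \<le> quad y"
    using continuous_attains_inf[OF cpt _ cont] by auto
  have unit: "quad x \<le> quad y" if "sqnorm y = 1" for y
  proof -
    have "quad (\<lambda>I. if I \<in> C then y I else 0) = quad y"
      by (simp add: quad_def cong: sum.cong)
    with x(2)[OF in_K[OF that]] show ?thesis by simp
  qed
  have "quad x * sqnorm y \<le> quad y" for y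
  proof (cases "sqnorm y = 0")
    case True
    then have "quad y = 0" by (simp add: sqnorm_eq_0 quad_def)
    with True show ?thesis by simp
  next
    case False
    \<comment> \<open>The factor that scales \<open>y\<close> to unit length.\<close>
    define c where "c = 1 / sqrt (sqnorm y)"
    have pos: "sqnorm y > 0" using False sqnorm_nonneg[of y] by simp
    have c2: "c\<^sup>2 = 1 / sqnorm y" using pos by (simp add: c_def power_divide)
    have "quad x \<le> quad (\<lambda>I. c * y I)"
      using pos by (intro unit) (simp add: sqnorm_scale c2)
    then show ?thesis using pos by (simp add: quad_scale c2 field_simps)
  qed
  with x(1) show ?thesis by (auto simp: K_def)
qed

section \<open>Variation of the form along one coordinate\<close>

lemma if_mult_eq: "(if P then 1 else 0) * c = (if P then c else (0::real))"
  by simp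

text \<open>Symmetry of \<open>a\<close> makes the two mixed sums equal, whence the factor 2. The
  linear coefficient contains row \<open>K\<close> of the eigenvalue equation.\<close>

lemma quad_perturb:
  assumes "K \<in> C"
  shows "quad (\<lambda>I. x I + t * (if I = K then 1 else 0)) =
    quad x + 2 * t * (\<Sum>J\<in>C. a K J * x J) + t\<^sup>2 * a K K"
proof -
  let ?e = "\<lambda>I. if I = K then 1 else (0::real)"
  have "quad (\<lambda>I. x I + t * ?e I) = quad x + (\<Sum>I\<in>C. \<Sum>J\<in>C. t * (?e I * (a I J * x J)))
     + (\<Sum>I\<in>C. \<Sum>J\<in>C. t * (?e J * (a I J * x I)))
     + (\<Sum>I\<in>C. \<Sum>J\<in>C. t\<^sup>2 * (?e I * (?e J * a I J)))"
    unfolding quad_def sum.distrib[symmetric]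
    by (intro sum.cong refl) (simp add: algebra_simps power2_eq_square)
  moreover have "(\<Sum>I\<in>C. \<Sum>J\<in>C. t * (?e I * (a I J * x J))) = t * (\<Sum>J\<in>C. a K J * x J)"
    using fin assms by (simp only: sum_distrib_left[symmetric]) (simp add: if_mult_eq)
  moreover have "(\<Sum>I\<in>C. \<Sum>J\<in>C. t * (?e J * (a I J * x I))) = t * (\<Sum>J\<in>C. a K J * x J)"
    using fin assms sym by (simp add: if_mult_eq flip: sum_distrib_left)
  moreover have "(\<Sum>I\<in>C. \<Sum>J\<in>C. t\<^sup>2 * (?e I * (?e J * a I J))) = t\<^sup>2 * a K K"
    using fin assms by (simp only: sum_distrib_left[symmetric]) (simp add: if_mult_eq)
  ultimately show ?thesis by simp
qed

lemma sqnorm_perturb: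
  assumes "K \<in> C"
  shows "sqnorm (\<lambda>I. x I + t * (if I = K then 1 else 0)) = sqnorm x + 2 * t * x K + t\<^sup>2"
proof -
  let ?e = "\<lambda>I. if I = K then 1 else (0::real)"
  have "sqnorm (\<lambda>I. x I + t * ?e I) = sqnorm x + (\<Sum>I\<in>C. ?e I * (2 * t * x I + t\<^sup>2))"
    unfolding sqnorm_def sum.distrib[symmetric]
    by (intro sum.cong refl) (simp add: algebra_simps power2_eq_square)
  then show ?thesis using fin assms by (simp add: if_mult_eq)
qed

text \<open>The form \<open>quad y - E * sqnorm y\<close> is nonnegative and vanishes at
  \<open>x\<close>, so its linear term in every coordinate direction must vanish there; these linear
  terms are the eigenvalue equations.\<close>

lemma minimizer_eigen:
  assumes min: "\<And>y. E * sqnorm y \<le> quad y" and eq: "quad x = E * sqnorm x"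
  shows "eigen E x"
  unfolding eigen_def
proof
  fix K assume K: "K \<in> C"
  define b where "b = (\<Sum>J\<in>C. a K J * x J) - E * x K"
  define d where "d = a K K - E"
  have nonneg: "0 \<le> 2 * t * b + t\<^sup>2 * d" for t
    using min[of "\<lambda>I. x I + t * (if I = K then 1 else 0)"]
    by (simp add: quad_perturb sqnorm_perturb K eq b_def d_def algebra_simps)
  have "b = 0"
  proof (rule ccontr)
    assume "b \<noteq> 0"
    \<comment> \<open>Small enough that at \<open>t = - r * b\<close> the linear term outweighs the
      quadratic one, whatever the size and sign of \<open>d\<close>.\<close>
    define r where "r = 1 / (\<bar>d\<bar> + 1)"
    have r: "r > 0" "r * d < 1"
      by (auto simp: r_def field_simps)
    have "2 * (- r * b) * b + (- r * b)\<^sup>2 * d = r * b\<^sup>2 * (r * d - 2)"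
      by (simp add: algebra_simps power2_eq_square)
    also have "\<dots> < 0"
      using r \<open>b \<noteq> 0\<close> by (intro mult_pos_neg) auto
    finally show False using nonneg[of "- r * b"] by simp
  qed
  then show "(\<Sum>J\<in>C. a K J * x J) = E * x K" by (simp add: b_def)
qed

text \<open>At a zero entry \<open>I\<close> the eigenvalue equation reads \<open>0\<close> on the
  right, while all terms on the left are nonpositive; irreducibility applied to the zero set
  supplies a strictly negative term.\<close>

lemma nonneg_eigen_pos:
  assumes x: "eigen E x" "\<And>I. I \<in> C \<Longrightarrow> x I \<ge> 0" and "\<exists>I\<in>C. x I \<noteq> 0"
  shows "\<forall>I\<in>C. x I > 0"
proof (rule ccontr)
  assume "\<not> ?thesis"
  then have "{I \<in> C. x I = 0} \<noteq> {}" using x(2) by force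
  moreover have "{I \<in> C. x I = 0} \<noteq> C" using assms(3) by auto
  ultimately obtain I J where IJ: "I \<in> C" "x I = 0" "J \<in> C" "x J \<noteq> 0" "a I J \<noteq> 0"
    using irreducible[of "{I \<in> C. x I = 0}"] by auto
  \<comment> \<open>The diagonal term, whose coefficient may have either sign, drops out because
    \<open>x I = 0\<close>.\<close>
  have le: "a I L * x L \<le> 0" if "L \<in> C" for L
    using that IJ off_diag[of I L] x(2)[of L] by (cases "L = I") (auto simp: mult_nonpos_nonneg)
  have "a I J < 0" using IJ off_diag[of I J] by fastforce
  then have "a I J * x J < 0" using IJ x(2)[of J] by (simp add: mult_neg_pos)
  then have "(\<Sum>L\<in>C. a I L * x L) < (\<Sum>L\<in>C. 0)"
    using IJ le fin by (intro sum_strict_mono_ex1) auto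
  then show False using x(1) IJ by (simp add: eigen_def)
qed

lemma eigen_diff:
  assumes "eigen E x" "eigen E y"
  shows "eigen E (\<lambda>I. y I - t * x I)"
  unfolding eigen_def
proof
  fix I assume "I \<in> C"
  have "(\<Sum>J\<in>C. a I J * (y J - t * x J)) = (\<Sum>J\<in>C. a I J * y J) - t * (\<Sum>J\<in>C. a I J * x J)"
    by (simp add: algebra_simps sum_subtractf sum_distrib_left)
  then show "(\<Sum>J\<in>C. a I J * (y J - t * x J)) = E * (y I - t * x I)"
    using assms \<open>I \<in> C\<close> by (simp add: eigen_def algebra_simps)
qed

text \<open>Subtracting from \<open>y\<close> the largest multiple of \<open>x\<close> that lies below it leaves a nonnegative
  vector with a zero entry.\<close>

lemma eigen_multiple:
  assumes x: "eigen E x" "\<forall>I\<in>C. x I > 0" and y: "eigen E y"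
  shows "\<exists>t. \<forall>I\<in>C. y I = t * x I"
proof -
  define t where "t = Min ((\<lambda>I. y I / x I) ` C)"
  have "t \<in> (\<lambda>I. y I / x I) ` C"
    unfolding t_def using fin nonempty by (intro Min_in) auto
  then obtain K where K: "K \<in> C" "t = y K / x K" by auto
  have "t \<le> y I / x I" if "I \<in> C" for I
    unfolding t_def using fin that by (intro Min_le) auto
  then have nonneg: "y I - t * x I \<ge> 0" if "I \<in> C" for I
    using that x(2) by (force simp: field_simps)
  have "y K - t * x K = 0" using K x(2) by force
  \<comment> \<open>A nonzero remainder would be positive everywhere by
    \<open>nonneg_eigen_pos\<close>, contradicting its zero at \<open>K\<close>.\<close>
  then have "\<forall>I\<in>C. y I - t * x I = 0"
    using nonneg_eigen_pos[OF eigen_diff[OF x(1) y, of t] nonneg] K(1) by force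
  then show ?thesis by auto
qed

text \<open>The absolute values of a minimizer have the same norm and no larger form, so they are
  again a minimizer, hence a nonnegative eigenvector, hence positive. The last bound identifies
  \<open>E\<close> as the lowest eigenvalue.\<close>

theorem perron_frobenius:
  obtains E x where "eigen E x" "\<forall>I\<in>C. x I > 0"
    "\<forall>y. E * sqnorm y \<le> quad y"
proof -
  obtain x where x: "sqnorm x = 1" "\<And>y. quad x * sqnorm y \<le> quad y"
    using ex_minimizer by blast
  let ?z = "\<lambda>I. \<bar>x I\<bar>"
  have z: "sqnorm ?z = 1" using x(1) by (simp add: sqnorm_def)
  have "quad ?z = quad x * sqnorm ?z"
    using quad_abs_le[of x] x(2)[of ?z] z by simp
  with x(2) have "eigen (quad x) ?z" by (rule minimizer_eigen)
  moreover have "\<exists>I\<in>C. ?z I \<noteq> 0" using z sqnorm_eq_0[of ?z] by auto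
  ultimately show ?thesis using that x(2) nonneg_eigen_pos[of "quad x" ?z] by simp
qed

end

section \<open>Ground states of irreducible stoquastic operators\<close>

lemma finite_configs: "finite (configs M N)"
  by (rule finite_subset[of _ "Pow (sites M)"]) (auto simp: configs_def sites_def)

text \<open>The matrix and the eigenvalues are real, so a complex vector solves the eigenvalue
  equation iff its real and imaginary parts do. The factor \<open>c \<noteq> 0\<close> later shows
  that no ground state has a zero entry.\<close>

lemma stoquastic_ground_state:
  assumes a: "irreducible_stoquastic (configs M N) a"
    and range: "\<And>\<psi>. \<psi> \<in> nspace M N \<Longrightarrow> A \<psi> \<in> nspace M N"
    and mat: "\<And>\<psi> I. \<psi> \<in> nspace M N \<Longrightarrow> I \<in> configs M N \<Longrightarrow>
      A \<psi> I = (\<Sum>J\<in>configs M N. complex_of_real (a I J) * \<psi> J)"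
  obtains \<Psi> where "is_ground_state M N A \<Psi>"
    "\<And>I. I \<in> configs M N \<Longrightarrow> \<Psi> I \<in> \<real> \<and> Re (\<Psi> I) > 0"
    "\<And>\<phi>. is_ground_state M N A \<phi> \<Longrightarrow> \<exists>c. c \<noteq> 0 \<and> \<phi> = (\<lambda>I. c * \<Psi> I)"
proof -
  interpret irreducible_stoquastic "configs M N" a by (fact a)
  have eigenvector_iff: "is_eigenvector M N A E \<psi> \<longleftrightarrow>
      \<psi> \<in> nspace M N \<and> \<psi> \<noteq> (\<lambda>I. 0) \<and> eigen E (\<lambda>I. Re (\<psi> I)) \<and> eigen E (\<lambda>I. Im (\<psi> I))"
    for E \<psi>
  proof (cases "\<psi> \<in> nspace M N")
    case True
    have "A \<psi> = (\<lambda>I. complex_of_real E * \<psi> I) \<longleftrightarrow>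
        (\<forall>I\<in>configs M N. A \<psi> I = complex_of_real E * \<psi> I)"
      using True range[OF True] by (auto simp: nspace_def fun_eq_iff)
    also have "\<dots> \<longleftrightarrow> eigen E (\<lambda>I. Re (\<psi> I)) \<and> eigen E (\<lambda>I. Im (\<psi> I))"
      using True by (auto simp: mat complex_eq_iff eigen_def)
    finally show ?thesis using True by (simp add: is_eigenvector_def)
  qed (simp add: is_eigenvector_def)
  obtain E x where x: "eigen E x" "\<forall>I\<in>configs M N. x I > 0"
    and min: "\<forall>y. E * sqnorm y \<le> quad y"
    using perron_frobenius by blast
  define \<Psi> where "\<Psi> = (\<lambda>I. if I \<in> configs M N then complex_of_real (x I) else 0)"
  have "eigen E (\<lambda>I. Re (\<Psi> I))" "eigen E (\<lambda>I. Im (\<Psi> I))"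
    using x(1) by (simp_all add: \<Psi>_def eigen_def)
  moreover have "\<Psi> \<noteq> (\<lambda>I. 0)"
  proof -
    obtain I where "I \<in> configs M N" using nonempty by auto
    with x(2) have "\<Psi> I \<noteq> 0" by (auto simp: \<Psi>_def)
    then show ?thesis by auto
  qed
  moreover have "\<Psi> \<in> nspace M N" by (simp add: nspace_def \<Psi>_def)
  ultimately have ev: "is_eigenvector M N A E \<Psi>" by (simp add: eigenvector_iff)
  have real_min: "E \<le> E'" if "eigen E' y" "I \<in> configs M N" "y I \<noteq> 0" for E' y I
  proof -
    have "sqnorm y > 0"
      using that sqnorm_eq_0[of y] sqnorm_nonneg[of y] by force
    moreover have "E * sqnorm y \<le> E' * sqnorm y"
      using min[rule_format, of y] quad_eigen[OF that(1)] by simp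
    ultimately show ?thesis by simp
  qed
  have lowest: "E \<le> E'" if "is_eigenvector M N A E' \<phi>" for E' \<phi>
  proof -
    have "\<phi> \<noteq> (\<lambda>I. 0)" using that by (simp add: is_eigenvector_def)
    then obtain I where I: "\<phi> I \<noteq> 0" by (auto simp: fun_eq_iff)
    then have "I \<in> configs M N" using that by (auto simp: is_eigenvector_def nspace_def)
    then show ?thesis
      using I that real_min[of E' "\<lambda>I. Re (\<phi> I)" I] real_min[of E' "\<lambda>I. Im (\<phi> I)" I]
      by (auto simp: eigenvector_iff complex_eq_iff)
  qed
  show ?thesis
  proof (rule that)
    show "is_ground_state M N A \<Psi>"
      using ev lowest by (auto simp: is_ground_state_def)
    show "\<Psi> I \<in> \<real> \<and> Re (\<Psi> I) > 0" if "I \<in> configs M N" for I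
      using x(2) that by (simp add: \<Psi>_def)
  next
    fix \<phi> assume "is_ground_state M N A \<phi>"
    then obtain E' where E': "is_eigenvector M N A E' \<phi>"
      "\<And>E'' \<phi>'. is_eigenvector M N A E'' \<phi>' \<Longrightarrow> E' \<le> E''"
      by (auto simp: is_ground_state_def)
    have "E' = E" using E'(2)[OF ev] lowest[OF E'(1)] by simp
    with E'(1) have \<phi>: "\<phi> \<in> nspace M N" "\<phi> \<noteq> (\<lambda>I. 0)"
      "eigen E (\<lambda>I. Re (\<phi> I))" "eigen E (\<lambda>I. Im (\<phi> I))"
      by (auto simp: eigenvector_iff)
    \<comment> \<open>Both parts belong to the same eigenvalue, so both are real multiples of the
      one positive vector \<open>x\<close>.\<close>
    obtain r s where "\<forall>I\<in>configs M N. Re (\<phi> I) = r * x I" "\<forall>I\<in>configs M N. Im (\<phi> I) = s * x I"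
      using eigen_multiple[OF x \<phi>(3)] eigen_multiple[OF x \<phi>(4)] by blast
    then have "\<phi> = (\<lambda>I. Complex r s * \<Psi> I)"
      using \<phi>(1) by (auto simp: fun_eq_iff \<Psi>_def nspace_def complex_eq_iff)
    moreover from this \<phi>(2) have "Complex r s \<noteq> 0" by auto
    ultimately show "\<exists>c. c \<noteq> 0 \<and> \<phi> = (\<lambda>I. c * \<Psi> I)" by blast
  qed
qed


section \<open>Hopping on a chain\<close>

text \<open>The condition \<open>j \<notin> I - {i}\<close> admits \<open>j = i\<close>, so diagonal
  entries of \<open>h\<close> count as trivial moves.\<close>

lemma move_configs:
  assumes "I \<in> configs M N" "i \<in> I" "j \<in> sites M" "j \<notin> I - {i}"
  shows "insert j (I - {i}) \<in> configs M N"
proof -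
  have "finite I" using assms(1) by (auto simp: configs_def sites_def intro: finite_subset)
  then have "card (insert j (I - {i})) = card I"
    using card_Suc_Diff1[of I i] assms by simp
  then show ?thesis using assms by (auto simp: configs_def)
qed

lemma move_back:
  assumes "i \<in> I" "j \<notin> I - {i}"
  shows "insert i (insert j (I - {i}) - {j}) = I" "j \<in> insert j (I - {i})"
    "i \<notin> insert j (I - {i}) - {j}"
  using assms by auto

text \<open>No particle sits strictly between two neighbouring sites, so a nearest-neighbour hop costs
  no sign.\<close>

lemma neighbour_sign:
  assumes "i \<in> I" "j \<notin> I - {i}" "\<bar>int i - int j\<bar> \<le> 1"
  shows "site_sign i I * site_sign j (I - {i}) = 1"
proof -
  have "k \<in> I \<and> k < i \<longleftrightarrow> k \<in> I - {i} \<and> k < j" for k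
    using assms by (cases "k = i"; cases "k = j") auto
  then have "site_sign j (I - {i}) = site_sign i I"
    by (simp add: site_sign_def)
  then show ?thesis by simp
qed

lemma create_annihilate:
  "create i (annihilate j \<psi>) I = (if i \<in> I \<and> j \<notin> I - {i}
    then site_sign i I * site_sign j (I - {i}) * \<psi> (insert j (I - {i})) else 0)"
  by (simp add: create_def annihilate_def)

text \<open>The matrix element of the one-body operator between \<open>e_I\<close> and
  \<open>e_J\<close> with all fermionic signs left out; for \<open>I = J\<close> it collects the
  on-site entries \<open>h i i\<close> of the occupied sites.\<close>

definition hop :: "nat \<Rightarrow> (nat \<Rightarrow> nat \<Rightarrow> real) \<Rightarrow> nat set \<Rightarrow> nat set \<Rightarrow> real" where
  "hop M h I J = (\<Sum>i\<in>sites M. \<Sum>j\<in>sites M.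
     if i \<in> I \<and> j \<notin> I - {i} \<and> insert j (I - {i}) = J then h i j else 0)"

text \<open>Undoing a move exchanges the roles of \<open>i\<close> and \<open>j\<close>, which
  matches the terms of both sums.\<close>

lemma hop_sym:
  assumes "\<forall>i\<in>sites M. \<forall>j\<in>sites M. h i j = h j i"
  shows "hop M h I J = hop M h J I"
proof -
  have "hop M h I J = (\<Sum>j\<in>sites M. \<Sum>i\<in>sites M.
     if i \<in> I \<and> j \<notin> I - {i} \<and> insert j (I - {i}) = J then h i j else 0)"
    unfolding hop_def by (rule sum.swap)
  also have "\<dots> = hop M h J I"
    unfolding hop_def
  proof (intro sum.cong refl if_cong)
    fix i j assume ij: "j \<in> sites M" "i \<in> sites M"
    show "i \<in> I \<and> j \<notin> I - {i} \<and> insert j (I - {i}) = J \<longleftrightarrow>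
        j \<in> J \<and> i \<notin> J - {j} \<and> insert i (J - {j}) = I"
      using move_back[of i I j] move_back[of j J i] by blast
    show "h i j = h j i" using assms ij by blast
  qed
  finally show ?thesis .
qed

text \<open>A trivial move leads back to \<open>I\<close>, so for \<open>I \<noteq> J\<close> only
  off-diagonal entries of \<open>h\<close> survive.\<close>

lemma hop_term_nonpos:
  fixes h :: "nat \<Rightarrow> nat \<Rightarrow> real"
  assumes "\<forall>i\<in>sites M. \<forall>j\<in>sites M. i \<noteq> j \<longrightarrow> h i j \<le> 0" "I \<noteq> J" "i \<in> sites M" "j \<in> sites M"
  shows "(if i \<in> I \<and> j \<notin> I - {i} \<and> insert j (I - {i}) = J then h i j else 0) \<le> 0"
proof (cases "i = j")
  case True
  then have "insert j (I - {i}) \<noteq> J" if "i \<in> I" using that assms(2) by (simp add: insert_absorb)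
  then show ?thesis by auto
qed (use assms in simp)

lemma hop_nonpos:
  assumes "\<forall>i\<in>sites M. \<forall>j\<in>sites M. i \<noteq> j \<longrightarrow> h i j \<le> 0" "I \<noteq> J"
  shows "hop M h I J \<le> 0"
  unfolding hop_def by (intro sum_nonpos hop_term_nonpos[OF assms])

text \<open>Nonpositive terms cannot cancel, so a single nonzero one decides the sign of the
  sum.\<close>

lemma hop_neg:
  assumes h: "\<forall>i\<in>sites M. \<forall>j\<in>sites M. i \<noteq> j \<longrightarrow> h i j \<le> 0"
    and "i \<in> sites M" "j \<in> sites M" "i \<in> I" "j \<notin> I" "h i j \<noteq> 0"
  shows "hop M h I (insert j (I - {i})) < 0"
proof -
  define J where "J = insert j (I - {i})"
  define f where "f = (\<lambda>i j. if i \<in> I \<and> j \<notin> I - {i} \<and> insert j (I - {i}) = J then h i j else 0)"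
  have ne: "I \<noteq> J" using assms by (auto simp: J_def)
  have f: "f k l \<le> 0" if "k \<in> sites M" "l \<in> sites M" for k l
    unfolding f_def by (rule hop_term_nonpos[OF h ne that])
  have fin: "finite (sites M)" by (simp add: sites_def)
  have "f i j < 0" using assms by (force simp: f_def J_def less_le)
  then have "(\<Sum>l\<in>sites M. f i l) < (\<Sum>l\<in>sites M. 0)"
    using fin assms f by (intro sum_strict_mono_ex1) auto
  then have "(\<Sum>k\<in>sites M. \<Sum>l\<in>sites M. f k l) < (\<Sum>k\<in>sites M. 0)"
    using fin assms f by (intro sum_strict_mono_ex1) (auto intro: sum_nonpos)
  then show ?thesis by (simp add: hop_def f_def J_def)
qed

section \<open>The one-body operator in the configuration basis\<close>

lemma one_body_nspace:
  assumes "\<psi> \<in> nspace M N"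
  shows "one_body M h \<psi> \<in> nspace M N"
proof -
  have "create i (annihilate j \<psi>) I = 0"
    if "I \<notin> configs M N" "i \<in> sites M" "j \<in> sites M" for I i j
  proof (cases "i \<in> I \<and> j \<notin> I - {i}")
    case True
    \<comment> \<open>Otherwise moving the particle back would make \<open>I\<close> a
      configuration.\<close>
    then have "insert j (I - {i}) \<notin> configs M N"
      using that(1,2) move_back[of i I j] move_configs[of "insert j (I - {i})" M N j i] by metis
    then show ?thesis using assms by (simp add: create_annihilate nspace_def)
  qed (simp only: create_annihilate if_False)
  then show ?thesis unfolding one_body_def nspace_def by simp
qed

lemma one_body_chain:
  assumes "linear_chain M h" "\<psi> \<in> nspace M N" "I \<in> configs M N"
  shows "one_body M (\<lambda>i j. complex_of_real (h i j)) \<psi> I =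
    (\<Sum>J\<in>configs M N. complex_of_real (hop M h I J) * \<psi> J)"
proof -
  \<comment> \<open>Each term reaches a single configuration; writing it as a sum over all
    \<open>J\<close> allows the sums to be exchanged.\<close>
  have tm: "complex_of_real (h i j) * create i (annihilate j \<psi>) I =
      (\<Sum>J\<in>configs M N. complex_of_real
        (if i \<in> I \<and> j \<notin> I - {i} \<and> insert j (I - {i}) = J then h i j else 0) * \<psi> J)"
    if ij: "i \<in> sites M" "j \<in> sites M" for i j
  proof (cases "i \<in> I \<and> j \<notin> I - {i}")
    case True
    let ?J = "insert j (I - {i})"
    have J: "?J \<in> configs M N" using assms(3) that True by (intro move_configs) auto
    have "(\<Sum>J\<in>configs M N. complex_of_real
        (if i \<in> I \<and> j \<notin> I - {i} \<and> ?J = J then h i j else 0) * \<psi> J) =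
        (\<Sum>J\<in>configs M N. if ?J = J then complex_of_real (h i j) * \<psi> J else 0)"
      using True by (intro sum.cong refl) simp
    also have "\<dots> = complex_of_real (h i j) * \<psi> ?J"
      using J by (simp only: sum.delta'[OF finite_configs] if_True)
    finally have "(\<Sum>J\<in>configs M N. complex_of_real
        (if i \<in> I \<and> j \<notin> I - {i} \<and> ?J = J then h i j else 0) * \<psi> J) =
        complex_of_real (h i j) * \<psi> ?J" .
    \<comment> \<open>Longer hops could carry a sign, but the chain has no matrix entry for
      them.\<close>
    moreover have "h i j = 0" if "\<not> \<bar>int i - int j\<bar> \<le> 1"
    proof -
      have "\<not> graph_adj M h i j"
        using that assms(1) ij by (auto simp: linear_chain_def)
      moreover have "i \<noteq> j" using that by auto
      ultimately show ?thesis using ij by (simp add: graph_adj_def)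
    qed
    ultimately show ?thesis
      using True neighbour_sign[of i I j]
      by (cases "\<bar>int i - int j\<bar> \<le> 1") (simp_all add: create_annihilate)
  next
    case False
    then show ?thesis
      by (simp only: create_annihilate conj_assoc[symmetric] simp_thms if_False of_real_0
          mult_zero_left mult_zero_right sum.neutral_const)
  qed
  have "one_body M (\<lambda>i j. complex_of_real (h i j)) \<psi> I =
      (\<Sum>i\<in>sites M. \<Sum>j\<in>sites M. \<Sum>J\<in>configs M N. complex_of_real
        (if i \<in> I \<and> j \<notin> I - {i} \<and> insert j (I - {i}) = J then h i j else 0) * \<psi> J)"
    unfolding one_body_def by (intro sum.cong refl tm)
  also have "\<dots> = (\<Sum>i\<in>sites M. \<Sum>J\<in>configs M N. \<Sum>j\<in>sites M. complex_of_real
        (if i \<in> I \<and> j \<notin> I - {i} \<and> insert j (I - {i}) = J then h i j else 0) * \<psi> J)"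
    by (intro sum.cong refl sum.swap)
  also have "\<dots> = (\<Sum>J\<in>configs M N. \<Sum>i\<in>sites M. \<Sum>j\<in>sites M. complex_of_real
        (if i \<in> I \<and> j \<notin> I - {i} \<and> insert j (I - {i}) = J then h i j else 0) * \<psi> J)"
    by (rule sum.swap)
  finally show ?thesis by (simp only: hop_def of_real_sum sum_distrib_right)
qed

text \<open>Each downward hop lowers the sum of the occupied positions, so the hops end; a
  configuration that allows none has no gap below any particle.\<close>

lemma packed_config_reachable:
  assumes S: "S \<subseteq> configs M N"
    and closed: "\<And>I k. I \<in> S \<Longrightarrow> Suc k \<in> I \<Longrightarrow> k \<in> sites M \<Longrightarrow> k \<notin> I \<Longrightarrow> insert k (I - {Suc k}) \<in> S"
    and "I \<in> S"
  shows "{1..N} \<in> S"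
  using \<open>I \<in> S\<close>
proof (induction "\<Sum>I" arbitrary: I rule: less_induct)
  case less
  have I: "I \<subseteq> sites M" "card I = N" "finite I"
    using S less.prems by (auto simp: configs_def sites_def intro: finite_subset)
  show ?case
  proof (cases "\<exists>k. Suc k \<in> I \<and> k \<in> sites M \<and> k \<notin> I")
    case True
    then obtain k where k: "Suc k \<in> I" "k \<in> sites M" "k \<notin> I" by blast
    have "\<Sum>(insert k (I - {Suc k})) < \<Sum>I"
      using k I(3) by (simp add: sum.remove[of I "Suc k"])
    then show ?thesis using less.hyps closed[OF less.prems k] by blast
  next
    case False
    have down: "{1..m} \<subseteq> I" if "m \<in> I" for m
      using that
    proof (induction m)
      case (Suc m)
      have "m \<in> I" if "m \<noteq> 0"
        using False Suc.prems I(1) that by (auto simp: sites_def)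
      with Suc show ?case by (cases "m = 0") (auto simp: atLeastAtMostSuc_conv)
    qed simp
    \<comment> \<open>If \<open>m \<in> I\<close>, then \<open>{1..m} \<subseteq> I\<close>, so
      \<open>m\<close> is at most \<open>card I = N\<close>.\<close>
    have "I \<subseteq> {1..N}"
    proof
      fix m assume "m \<in> I"
      then show "m \<in> {1..N}"
        using card_mono[OF I(3) down] I by (auto simp: sites_def)
    qed
    then have "I = {1..N}" using I(2) by (intro card_subset_eq) auto
    with less.prems show ?thesis by simp
  qed
qed

text \<open>If no matrix entry crossed the cut, both \<open>S\<close> and its complement would be
  closed under downward hops, and both would contain \<open>{1..N}\<close>.\<close>

lemma chain_irreducible:
  assumes "N < M"
    and h_sym: "\<forall>i\<in>sites M. \<forall>j\<in>sites M. h i j = h j i"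
    and h_nonpos: "\<forall>i\<in>sites M. \<forall>j\<in>sites M. i \<noteq> j \<longrightarrow> h i j \<le> 0"
    and h_chain: "linear_chain M h"
  shows "irreducible_stoquastic (configs M N) (\<lambda>I J. hop M h I J + (if I = J then w I else 0))"
proof
  show "finite (configs M N)" by (rule finite_configs)
  have "{1..N} \<in> configs M N" using \<open>N < M\<close> by (auto simp: configs_def sites_def)
  then show "configs M N \<noteq> {}" by auto
  show "hop M h I J + (if I = J then w I else 0) = hop M h J I + (if J = I then w J else 0)" for I J
    using hop_sym[OF h_sym, of I J] by simp
  show "hop M h I J + (if I = J then w I else 0) \<le> 0" if "I \<noteq> J" for I J
    using hop_nonpos[OF h_nonpos that] that by simp
  fix S assume S: "S \<subseteq> configs M N" "S \<noteq> {}" "S \<noteq> configs M N"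
  show "\<exists>I\<in>S. \<exists>J\<in>configs M N - S. hop M h I J + (if I = J then w I else 0) \<noteq> 0"
  proof (rule ccontr)
    assume none: "\<not> ?thesis"
    have zero: "hop M h I J = 0" if "I \<in> S" "J \<in> configs M N - S" for I J
    proof -
      have "hop M h I J + (if I = J then w I else 0) = 0"
        using none that by blast
      moreover have "I \<noteq> J" using that by blast
      ultimately show ?thesis by simp
    qed
    have neg: "hop M h I (insert k (I - {Suc k})) < 0" "insert k (I - {Suc k}) \<in> configs M N"
      if "I \<in> configs M N" "Suc k \<in> I" "k \<in> sites M" "k \<notin> I" for I k
    proof -
      have k: "Suc k \<in> sites M" using that by (auto simp: configs_def)
      have "graph_adj M h (Suc k) k"
        using h_chain k that(3) by (simp add: linear_chain_def)
      then have "h (Suc k) k \<noteq> 0" by (simp add: graph_adj_def)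
      with hop_neg[OF h_nonpos k] that show "hop M h I (insert k (I - {Suc k})) < 0" by blast
      show "insert k (I - {Suc k}) \<in> configs M N"
        using that by (intro move_configs) auto
    qed
    obtain I J where IJ: "I \<in> S" "J \<in> configs M N - S" using S by blast
    have "{1..N} \<in> S"
    proof (rule packed_config_reachable[OF S(1) _ IJ(1)])
      fix I k assume k: "I \<in> S" "Suc k \<in> I" "k \<in> sites M" "k \<notin> I"
      let ?J = "insert k (I - {Suc k})"
      have "I \<in> configs M N" using k(1) S(1) by blast
      then have "hop M h I ?J < 0" "?J \<in> configs M N" using neg k(2-4) by blast+
      then show "?J \<in> S" using zero[OF k(1), of ?J] by (cases "?J \<in> S") simp_all
    qed
    moreover have "{1..N} \<in> configs M N - S"
    proof (rule packed_config_reachable[OF _ _ IJ(2)])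
      fix I k assume k: "I \<in> configs M N - S" "Suc k \<in> I" "k \<in> sites M" "k \<notin> I"
      let ?J = "insert k (I - {Suc k})"
      have J: "hop M h I ?J < 0" "?J \<in> configs M N" using neg k by blast+
      \<comment> \<open>The fact \<open>zero\<close> covers only entries from \<open>S\<close> to
        its complement, so symmetry reverses the hop.\<close>
      then have "hop M h ?J I \<noteq> 0" using hop_sym[OF h_sym, of I ?J] by simp
      then have "?J \<notin> S" using zero[OF _ k(1), of ?J] by blast
      with J(2) show "?J \<in> configs M N - S" by blast
    qed blast
    ultimately show False by simp
  qed
qed


section \<open>Diagonal interactions and potentials\<close>

text \<open>Pairing with \<open>e_I\<close> reads off the coefficient at \<open>I\<close>, and
  self-adjointness moves \<open>W\<close> onto \<open>e_I\<close>, where it acts as a scalar.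
  Testing on \<open>e_I\<close> itself shows that this scalar is real.\<close>

lemma diagonal_self_adjoint:
  assumes sa: "self_adjoint M N W" and diag: "diagonal_operator M N W"
  obtains w where "\<And>\<psi> I. \<psi> \<in> nspace M N \<Longrightarrow> I \<in> configs M N \<Longrightarrow>
    W \<psi> I = complex_of_real (w I) * \<psi> I"
proof -
  have inner: "fock_inner M (\<lambda>J. c * basis_vec I J) \<psi> = cnj c * \<psi> I" if "I \<in> configs M N" for c I \<psi>
  proof -
    have "I \<in> Pow (sites M)" "finite (Pow (sites M))"
      using that by (auto simp: configs_def sites_def)
    then have "(\<Sum>J\<in>Pow (sites M). if J = I then cnj c * \<psi> J else 0) = cnj c * \<psi> I"
      by (simp only: sum.delta if_True)
    moreover have "cnj (c * basis_vec I J) * \<psi> J = (if J = I then cnj c * \<psi> J else 0)" for J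
      by (simp add: basis_vec_def)
    ultimately show ?thesis by (simp only: fock_inner_def)
  qed
  have bv: "basis_vec I \<in> nspace M N" if "I \<in> configs M N" for I
    using that by (auto simp: basis_vec_def nspace_def)
  have "\<exists>w. \<forall>\<psi>\<in>nspace M N. W \<psi> I = complex_of_real w * \<psi> I" if I: "I \<in> configs M N" for I
  proof -
    obtain c where c: "W (basis_vec I) = (\<lambda>J. c * basis_vec I J)"
      using diag I by (auto simp: diagonal_operator_def)
    have act: "W \<psi> I = cnj c * \<psi> I" if "\<psi> \<in> nspace M N" for \<psi>
    proof -
      have "fock_inner M (basis_vec I) (W \<psi>) = fock_inner M (W (basis_vec I)) \<psi>"
        using sa bv[OF I] that by (simp add: self_adjoint_def)
      then show ?thesis using inner[OF I, of 1 "W \<psi>"] inner[OF I, of c \<psi>] by (simp add: c)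
    qed
    have "cnj c = c" using act[OF bv[OF I]] c by (simp add: basis_vec_def)
    then have "cnj c = complex_of_real (Re c)" by (simp add: complex_eq_iff)
    with act show ?thesis by metis
  qed
  then show ?thesis using that by metis
qed

text \<open>A common eigenvector without zeros forces the sum of \<open>u\<close> over a configuration to be the same
  for all configurations; exchanging one occupied site for an empty one compares its values.\<close>

lemma common_eigenvector_constant_potential:
  assumes "1 \<le> N" "N < M"
    and "is_eigenvector M N A E \<Psi>" "is_eigenvector M N (op_add A (potential_op M u)) E' \<Psi>"
    and nz: "\<And>I. I \<in> configs M N \<Longrightarrow> \<Psi> I \<noteq> 0"
  shows "constant_potential M u"
proof -
  have sum_u: "(\<Sum>i\<in>I. u i) = E' - E" if I: "I \<in> configs M N" for I
  proof -
    have "A \<Psi> I + potential_op M u \<Psi> I = complex_of_real E' * \<Psi> I"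
      using assms(4) unfolding is_eigenvector_def op_add_def by metis
    moreover have "A \<Psi> I = complex_of_real E * \<Psi> I"
      using assms(3) unfolding is_eigenvector_def by metis
    ultimately have "complex_of_real (E + (\<Sum>i\<in>I. u i)) * \<Psi> I = complex_of_real E' * \<Psi> I"
      using I by (simp add: potential_op_apply configs_def algebra_simps)
    then have "E + (\<Sum>i\<in>I. u i) = E'"
      using nz[OF I] by (simp only: mult_cancel_right of_real_eq_iff) simp
    then show ?thesis by simp
  qed
  have eq: "u i = u j" if "i \<in> sites M" "j \<in> sites M" "i \<noteq> j" for i j
  proof -
    \<comment> \<open>Since \<open>N < M\<close>, the other \<open>M - 2\<close> sites have room for
      \<open>N - 1\<close> spectators, which the two compared configurations share.\<close>
    have "N - 1 \<le> card (sites M - {i, j})"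
      using that assms(1,2) by (simp add: sites_def)
    then obtain T where T: "T \<subseteq> sites M - {i, j}" "card T = N - 1" "finite T"
      by (rule obtain_subset_with_card_n)
    then have "insert i T \<in> configs M N" "insert j T \<in> configs M N" "i \<notin> T" "j \<notin> T"
      using that assms(1) by (auto simp: configs_def card_insert_if)
    with sum_u[of "insert i T"] sum_u[of "insert j T"] T(3) show ?thesis by simp
  qed
  then show ?thesis by (metis constant_potential_def)
qed

theorem theorem17:
  fixes M N :: nat
    and h :: "nat \<Rightarrow> nat \<Rightarrow> real"
    and W H :: "fock \<Rightarrow> fock"
  assumes "1 \<le> N" and "N < M"
    and h_sym: "\<forall>i\<in>sites M. \<forall>j\<in>sites M. h i j = h j i"
    and h_nonpos: "\<forall>i\<in>sites M. \<forall>j\<in>sites M. i \<noteq> j \<longrightarrow> h i j \<le> 0"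
    and h_chain: "linear_chain M h"
    and W_self_adjoint: "self_adjoint M N W"
    and W_diagonal: "diagonal_operator M N W"
    and H_def: "H = op_add (one_body M (\<lambda>i j. complex_of_real (h i j))) W"
  shows "nondegenerate_ground_state M N H \<and>
    (\<exists>\<Psi>. is_ground_state M N H \<Psi> \<and> (\<forall>I\<in>configs M N. \<Psi> I \<in> \<real> \<and> Re (\<Psi> I) > 0)) \<and>
    (\<forall>\<Psi>. is_ground_state M N H \<Psi> \<longrightarrow>
       (\<forall>H0 v. (\<forall>\<psi>\<in>nspace M N. H \<psi> = op_add H0 (potential_op M v) \<psi>) \<longrightarrow>
          uniquely_v_representable M N H0 v \<Psi>))"
proof -
  obtain w where w: "\<And>\<psi> I. \<psi> \<in> nspace M N \<Longrightarrow> I \<in> configs M N \<Longrightarrow>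
      W \<psi> I = complex_of_real (w I) * \<psi> I"
    using diagonal_self_adjoint[OF W_self_adjoint W_diagonal] by blast
  \<comment> \<open>The interaction enters only on the diagonal, where stoquasticity imposes no
    sign.\<close>
  let ?a = "\<lambda>I J. hop M h I J + (if I = J then w I else 0)"
  have mat: "H \<psi> I = (\<Sum>J\<in>configs M N. complex_of_real (?a I J) * \<psi> J)"
    if "\<psi> \<in> nspace M N" "I \<in> configs M N" for \<psi> I
  proof -
    have "complex_of_real (?a I J) * \<psi> J =
        complex_of_real (hop M h I J) * \<psi> J + (if I = J then complex_of_real (w J) * \<psi> J else 0)" for J
      by (simp add: algebra_simps)
    then show ?thesis
      using that by (simp add: H_def op_add_def one_body_chain[OF h_chain] w sum.distrib finite_configs)
  qed
  have range: "H \<psi> \<in> nspace M N" if "\<psi> \<in> nspace M N" for \<psi>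
    using one_body_nspace[OF that] W_self_adjoint that
    by (auto simp: H_def op_add_def nspace_def self_adjoint_def linear_operator_def)
  obtain \<Psi> where \<Psi>: "is_ground_state M N H \<Psi>"
    and pos: "\<And>I. I \<in> configs M N \<Longrightarrow> \<Psi> I \<in> \<real> \<and> Re (\<Psi> I) > 0"
    and uniq: "\<And>\<phi>. is_ground_state M N H \<phi> \<Longrightarrow> \<exists>c. c \<noteq> 0 \<and> \<phi> = (\<lambda>I. c * \<Psi> I)"
    using stoquastic_ground_state[OF chain_irreducible[OF \<open>N < M\<close> h_sym h_nonpos h_chain] range mat]
    by blast
  have "uniquely_v_representable M N H0 v \<phi>"
    if \<phi>: "is_ground_state M N H \<phi>"
      and H0: "\<forall>\<psi>\<in>nspace M N. H \<psi> = op_add H0 (potential_op M v) \<psi>" for \<phi> H0 v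
  proof -
    \<comment> \<open>Every ground state is a nonzero multiple of the positive one, so the argument
      covers all of them and not just \<open>\<Psi>\<close>.\<close>
    have nz: "\<phi> I \<noteq> 0" if "I \<in> configs M N" for I
      using uniq[OF \<phi>] pos[OF that] by auto
    have "constant_potential M u" if gs: "is_ground_state M N (op_add H (potential_op M u)) \<phi>" for u
    proof -
      obtain E E' where "is_eigenvector M N H E \<phi>"
        "is_eigenvector M N (op_add H (potential_op M u)) E' \<phi>"
        using \<phi> gs unfolding is_ground_state_def by blast
      then show ?thesis
        using nz by (rule common_eigenvector_constant_potential[OF \<open>1 \<le> N\<close> \<open>N < M\<close>])
    qed
    with \<phi> H0 show ?thesis
      by (subst uniquely_v_representable_iff[of M N H]) auto
  qed
  moreover have "nondegenerate_ground_state M N H"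
    unfolding nondegenerate_ground_state_def using \<Psi> uniq by blast
  ultimately show ?thesis using \<Psi> pos by blast
qed

end
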